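(* Let $\{X_n;\,n\ge1\}$ be a sequence of independent copies of a $\mathbf{B}$-valued random variable $X$, with $S_n=\sum_{k=1}^n X_k$. Then \[ \sum_{n=1}^{\infty}\frac1n\left(\frac{\mathbb{E}\|S_n\|}{n}\right)<\infty \] if and only if both \[ \sum_{n=1}^{\infty}\frac1n\left(\frac{\|S_n\|}{n}\right)<\infty\ \text{ almost surely} \] and \[ \mathbb{E}X=0\quad\text{and}\quad \mathbb{E}\|X\|\ln(1+\|X\|)<\infty . \]
   Context: $(\mathbf{B},\|\cdot\|)$ is a real separable Banach space with its Borel $\sigma$-algebra. The expected value $\mathbb{E}X$ of a $\mathbf B$-valued random variable $X$ is the Pettis integral: $\mathbb{E}X\in\mathbf B$ is the element with $\varphi(\mathbb{E}X)=\mathbb{E}\varphi(X)$ for every continuous linear functional $\varphi$ on $\mathbf B$. *)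

theory Defs
  imports "HOL-Probability.Probability"
begin

end

theory Submission
  imports Defs
begin

text \<open>
  Write \<open>q N = (\<Sum>n\<le>N. \<parallel>S\<^sub>n\<parallel> / n\<^sup>2)\<close>.

  If \<open>\<Sum>n. E\<parallel>S\<^sub>n\<parallel> / n\<^sup>2\<close> converges, then so does \<open>q\<close> almost surely, and \<open>n \<bar>E \<phi>(X)\<bar> \<le> C E\<parallel>S\<^sub>n\<parallel>\<close> rules
  out a nonzero mean because the harmonic series diverges. For the moment condition put
  \<open>c = (2 E\<parallel>X\<parallel> + 1) n\<close>. The events that \<open>X\<^sub>k\<close> is the only one of the first \<open>n\<close> summands of norm
  above \<open>c\<close> are disjoint, and on each of them \<open>\<parallel>X\<^sub>k\<parallel> \<le> \<parallel>S\<^sub>n\<parallel> + \<parallel>S\<^sub>n - X\<^sub>k\<parallel>\<close>. This yields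
  \<open>n E(\<parallel>X\<parallel>; \<parallel>X\<parallel> > c) \<le> 2 E\<parallel>S\<^sub>n\<parallel> + E\<parallel>S\<^bsub>n-1\<^esub>\<parallel>\<close>; divide by \<open>n\<^sup>2\<close> and sum over \<open>n\<close>.

  Conversely, choose \<open>t\<close> with \<open>P(sup q > t) \<le> 1/2\<close> and let \<open>\<tau>\<close> be the first \<open>m\<close> with \<open>q m > t\<close>.
  After time \<open>\<tau>\<close> the process restarts: \<open>q N \<le> t + 2 \<parallel>S\<^sub>\<tau>\<parallel> / \<tau> + R\<close>, where, given the past, \<open>R\<close>
  has mean at most \<open>E (q N)\<close>. Hence \<open>E (q N) \<le> t + 2 E (sup \<parallel>S\<^sub>m\<parallel> / m) + E (q N) / 2\<close>. The
  supremum is integrable under the \<open>L log L\<close> condition: it is controlled along dyadic \<open>m\<close> by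
  truncating at \<open>m\<close> and using second moments.
\<close>

subsection \<open>Elementary estimates\<close>

lemma ennreal_half_le_of_one_le_add:
  fixes w q :: ennreal
  assumes "1 \<le> w + q" "q \<le> 1/2"
  shows "1/2 \<le> w"
proof (rule ccontr)
  assume "\<not> 1/2 \<le> w"
  have half: "1/2 + 1/2 = (1 :: ennreal)"
    by (metis add_divide_distrib_ennreal ennreal_divide_self ennreal_numeral_less_top one_add_one top.not_eq_extremum zero_neq_numeral)
  have fin: "(1/2 :: ennreal) \<noteq> \<top>" by (simp add: ennreal_divide_eq_top_iff)
  have "w + q \<le> 1/2 + w" using add_left_mono[OF assms(2), of w] by (simp only: add.commute)
  also have "1/2 + w < 1/2 + (1/2 :: ennreal)"
    using \<open>\<not> 1/2 \<le> w\<close> fin unfolding ennreal_add_left_cancel_less not_le infinity_ennreal_def by blast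
  finally show False using assms(1) unfolding half by simp
qed

lemma mult_ln_le_harmonic_series:
  fixes x a :: real
  assumes "x \<ge> 0" "a > 0"
  shows "ennreal (x * ln (1 + x)) \<le> ennreal (ln (1 + a)) * ennreal x +
    (\<Sum>m. ennreal x * indicator {a * real (Suc m)<..} x / ennreal (real (Suc m)))"
proof (cases "x = 0")
  case False
  with assms have "x > 0" by simp
  define N where "N = nat \<lceil>x / a\<rceil> - 1"
  have ceil: "\<lceil>x / a\<rceil> \<ge> 1" using assms \<open>x > 0\<close> by simp
  then have N: "real N + 1 = \<lceil>x / a\<rceil>" unfolding N_def by linarith
  have 1: "x \<le> a * (real N + 1)"
    using mult_left_mono[OF le_of_int_ceiling[of "x / a"], of a] assms unfolding N by simp
  have 2: "a * real (Suc m) < x" if "m < N" for m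
  proof -
    have "real N < x / a" using N by linarith
    then have "a * real N < x" using assms by (simp add: field_simps)
    moreover have "a * real (Suc m) \<le> a * real N" using that assms by (intro mult_left_mono) auto
    ultimately show ?thesis by simp
  qed
  have "1 + x \<le> (1 + a) * (real N + 1)"
    using 1 assms by (simp add: algebra_simps)
  then have "ln (1 + x) \<le> ln ((1 + a) * (real N + 1))" using assms by simp
  also have "\<dots> = ln (1 + a) + ln (real N + 1)" using assms by (subst ln_mult) auto
  also have "\<dots> \<le> ln (1 + a) + (\<Sum>m<N. 1 / real (Suc m))"
    using harm_ge_ln[of N] by (simp add: harm_altdef inverse_eq_divide)
  finally have "x * ln (1 + x) \<le> x * (ln (1 + a) + (\<Sum>m<N. 1 / real (Suc m)))"
    using assms by (intro mult_left_mono) auto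
  also have "\<dots> = ln (1 + a) * x + (\<Sum>m<N. x / real (Suc m))"
    by (simp add: distrib_left sum_distrib_left mult.commute)
  finally have "x * ln (1 + x) \<le> ln (1 + a) * x + (\<Sum>m<N. x / real (Suc m))" .
  then have "ennreal (x * ln (1 + x)) \<le> ennreal (ln (1 + a)) * ennreal x + ennreal (\<Sum>m<N. x / real (Suc m))"
    using assms by (simp add: sum_nonneg flip: ennreal_mult ennreal_plus)
  also have "ennreal (\<Sum>m<N. x / real (Suc m)) = (\<Sum>m<N. ennreal x * indicator {a * real (Suc m)<..} x / ennreal (real (Suc m)))"
  proof -
    have "ennreal (\<Sum>m<N. x / real (Suc m)) = (\<Sum>m<N. ennreal (x / real (Suc m)))"
      using assms by (intro sum_ennreal[symmetric]) auto
    also have "\<dots> = (\<Sum>m<N. ennreal x * indicator {a * real (Suc m)<..} x / ennreal (real (Suc m)))"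
      using assms 2 by (intro sum.cong) (auto simp: divide_ennreal simp del: of_nat_Suc)
    finally show ?thesis .
  qed
  also have "\<dots> \<le> (\<Sum>m. ennreal x * indicator {a * real (Suc m)<..} x / ennreal (real (Suc m)))"
    by (rule sum_le_suminf) auto
  finally show ?thesis by (simp add: add_left_mono)
qed simp

lemma divide_left_mono_ennreal:
  fixes a b c :: ennreal
  assumes "b \<le> c"
  shows "a / c \<le> a / b"
proof -
  have "inverse c \<le> inverse b"
    using assms including ennreal.lifting by transfer (rule ereal_inverse_antimono)
  then show ?thesis unfolding divide_ennreal_def by (rule mult_left_mono) simp
qed

lemma dyadic_tail_sum_squares:
  fixes y :: real
  assumes "y \<ge> 0"
  shows "(\<Sum>j. ennreal (y\<^sup>2 * indicator {..2 ^ j} y / 2 ^ j)) \<le> ennreal (2 * y)"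
proof -
  define N where "N = (LEAST j. y \<le> 2 ^ j)"
  have ex: "\<exists>j. y \<le> 2 ^ j"
    using real_arch_pow[of 2 y] by (auto intro: less_imp_le)
  have N: "y \<le> 2 ^ N" unfolding N_def using ex by (rule LeastI_ex)
  have less: "j < N \<Longrightarrow> \<not> y \<le> 2 ^ j" for j unfolding N_def by (rule not_less_Least)
  have ge: "y \<le> 2 ^ (j + N)" for j
    using N power_increasing[of N "j + N" "2 :: real"] by linarith
  define f where "f j = y\<^sup>2 * indicator {..2 ^ j} y / 2 ^ j" for j :: nat
  have "(\<lambda>j. y\<^sup>2 / 2 ^ N * (1 / 2) ^ j) sums (y\<^sup>2 / 2 ^ N * (1 / (1 - 1 / 2)))"
    by (intro sums_mult geometric_sums) auto
  also have "(\<lambda>j. y\<^sup>2 / 2 ^ N * (1 / 2) ^ j) = (\<lambda>j. f (j + N))"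
    using ge by (auto simp: f_def power_add field_simps)
  finally have "f sums (y\<^sup>2 / 2 ^ N * 2 + (\<Sum>j<N. f j))"
    by (simp add: sums_iff_shift)
  also have "(\<Sum>j<N. f j) = 0" using less by (intro sum.neutral) (auto simp: f_def)
  finally have "(\<Sum>j. ennreal (f j)) = ennreal (y\<^sup>2 / 2 ^ N * 2)"
    by (intro suminf_ennreal_eq) (auto simp: f_def)
  also have "\<dots> \<le> ennreal (2 * y)"
    using mult_left_mono[OF N assms] by (intro ennreal_leI) (simp add: field_simps power2_eq_square)
  finally show ?thesis by (simp add: f_def)
qed

lemma dyadic_tail_sum_le_mult_ln:
  fixes y :: real
  assumes "y \<ge> 0"
  shows "(\<Sum>j. ennreal (y * indicator {2 ^ j<..} y)) \<le> ennreal y + ennreal (1 / ln 2) * ennreal (y * ln (1 + y))"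
proof -
  define N where "N = (LEAST j. y \<le> 2 ^ j)"
  have ex: "\<exists>j. y \<le> 2 ^ j"
    using real_arch_pow[of 2 y] by (auto intro: less_imp_le)
  have N: "y \<le> 2 ^ N" unfolding N_def using ex by (rule LeastI_ex)
  have less: "j < N \<Longrightarrow> \<not> y \<le> 2 ^ j" for j unfolding N_def by (rule not_less_Least)
  have ge: "y \<le> 2 ^ j" if "N \<le> j" for j
    using N power_increasing[OF that, of "2 :: real"] by linarith
  have "real N \<le> 1 + ln (1 + y) / ln 2"
  proof (cases N)
    case (Suc i)
    then have i: "2 ^ i < y" using less[of i] by simp
    then have "y > 0" by (smt (verit) zero_le_power)
    have "real i * ln 2 = ln (2 ^ i)" by (simp add: ln_realpow)
    also have "\<dots> \<le> ln (1 + y)" using i by (subst ln_le_cancel_iff) (auto simp: \<open>y > 0\<close> add_pos_pos)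
    finally show ?thesis using Suc by (simp add: field_simps)
  qed (use assms in simp)
  then have "real N * y \<le> y + 1 / ln 2 * (y * ln (1 + y))"
    using mult_right_mono[OF _ assms, of "real N" "1 + ln (1 + y) / ln 2"] by (simp add: field_simps)
  have "(\<Sum>j. ennreal (y * indicator {2 ^ j<..} y)) = (\<Sum>j<N. ennreal (y * indicator {2 ^ j<..} y))"
    by (intro suminf_finite) (auto simp: not_less indicator_def dest!: ge)
  also have "\<dots> \<le> (\<Sum>j<N. ennreal y)"
    using assms by (intro sum_mono ennreal_leI) (auto simp: indicator_def)
  also have "\<dots> = ennreal (real N * y)"
    using assms by (simp add: ennreal_mult ennreal_of_nat_eq_real_of_nat)
  also have "\<dots> \<le> ennreal (y + 1 / ln 2 * (y * ln (1 + y)))"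
    by (intro ennreal_leI) fact
  also have "\<dots> = ennreal y + ennreal (1 / ln 2 * (y * ln (1 + y)))"
    using assms by (intro ennreal_plus) auto
  also have "ennreal (1 / ln 2 * (y * ln (1 + y))) = ennreal (1 / ln 2) * ennreal (y * ln (1 + y))"
    using assms by (intro ennreal_mult) auto
  finally show ?thesis .
qed

lemma (in prob_space) expectation_square_sum_indep:
  fixes W :: "'i \<Rightarrow> 'a \<Rightarrow> real"
  assumes "finite I" "indep_vars (\<lambda>_. borel) W I"
    and "\<And>k. k \<in> I \<Longrightarrow> integrable M (W k)" "\<And>k. k \<in> I \<Longrightarrow> integrable M (\<lambda>\<omega>. (W k \<omega>)\<^sup>2)"
    and "\<And>k. k \<in> I \<Longrightarrow> expectation (W k) = 0"
  shows "integrable M (\<lambda>\<omega>. (\<Sum>k\<in>I. W k \<omega>)\<^sup>2) \<and>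
    expectation (\<lambda>\<omega>. (\<Sum>k\<in>I. W k \<omega>)\<^sup>2) = (\<Sum>k\<in>I. expectation (\<lambda>\<omega>. (W k \<omega>)\<^sup>2))"
  using assms
proof (induction I)
  case (insert i I)
  define T where "T \<omega> = (\<Sum>k\<in>I. W k \<omega>)" for \<omega>
  have IH: "integrable M (\<lambda>\<omega>. (T \<omega>)\<^sup>2)" "expectation (\<lambda>\<omega>. (T \<omega>)\<^sup>2) = (\<Sum>k\<in>I. expectation (\<lambda>\<omega>. (W k \<omega>)\<^sup>2))"
    unfolding T_def using insert.IH insert.prems by (auto intro: indep_vars_subset)
  have indep: "indep_var borel (W i) borel T"
    unfolding T_def using insert by (intro indep_vars_sum) auto
  have int: "integrable M (W i)" "integrable M T" "integrable M (\<lambda>\<omega>. (W i \<omega>)\<^sup>2)"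
    unfolding T_def using insert.prems by auto
  note WT = indep_var_integrable[OF indep int(1,2)]
  have exp_WT: "expectation (\<lambda>\<omega>. W i \<omega> * T \<omega>) = 0"
    using indep_var_lebesgue_integral[OF indep int(1,2)] insert.prems by simp
  have eq: "(\<Sum>k\<in>insert i I. W k \<omega>)\<^sup>2 = (W i \<omega>)\<^sup>2 + 2 * (W i \<omega> * T \<omega>) + (T \<omega>)\<^sup>2" for \<omega>
    using insert.hyps by (simp add: T_def power2_sum)
  show ?case
    unfolding eq using IH int WT exp_WT insert.hyps by simp
qed simp

lemma exists_dyadic_between:
  assumes "m > 0"
  shows "\<exists>j. m \<le> 2 ^ j \<and> (2 :: nat) ^ j \<le> 2 * m"
  using assms
proof (induction m rule: less_induct)
  case (less m)
  show ?case
  proof (cases "m = 1")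
    case True
    then show ?thesis by (intro exI[of _ 0]) auto
  next
    case False
    define k where "k = (m + 1) div 2"
    have "0 < k" "k < m" "m \<le> 2 * k" "2 * k \<le> m + 1" using False less.prems by (auto simp: k_def)
    then obtain j where "k \<le> 2 ^ j" "2 ^ j \<le> 2 * k" using less.IH by blast
    show ?thesis
    proof (cases "m \<le> 2 ^ j")
      case True
      then show ?thesis using \<open>2 ^ j \<le> 2 * k\<close> \<open>2 * k \<le> m + 1\<close> less.prems by (intro exI[of _ j]) auto
    next
      case False
      then show ?thesis using \<open>k \<le> 2 ^ j\<close> \<open>m \<le> 2 * k\<close> by (intro exI[of _ "Suc j"]) auto
    qed
  qed
qed

lemma sum_lessThan_add:
  fixes f :: "nat \<Rightarrow> 'a::comm_monoid_add"
  shows "(\<Sum>n<m + d. f n) = (\<Sum>n<m. f n) + (\<Sum>j<d. f (m + j))"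
  by (induction d) (auto simp: add.assoc)

lemma sum_inverse_squares_le:
  "(\<Sum>j<d. 1 / (real (Suc (Suc i + j)))\<^sup>2) \<le> 1 / real (Suc i) - 1 / real (Suc i + d)"
proof (induction d)
  case (Suc d)
  have "1 / (real (Suc i + d + 1))\<^sup>2 \<le> 1 / real (Suc i + d) - 1 / (real (Suc i + d + 1))"
  proof -
    define x where "x = real (Suc i + d)"
    have "x > 0" by (simp add: x_def)
    then have "1 / (x + 1)\<^sup>2 \<le> 1 / x - 1 / (x + 1)"
      by (simp add: divide_simps power2_eq_square)
    then show ?thesis by (simp add: x_def)
  qed
  with Suc.IH show ?case by (simp add: algebra_simps)
qed simp

subsection \<open>Independent copies and their partial sums\<close>

text \<open>The copies are indexed from \<open>0\<close>: \<open>Y k\<close> is the paper's \<open>X\<^bsub>k+1\<^esub>\<close>.\<close>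

locale iid_sequence = prob_space M for M :: "'a measure" +
  fixes X :: "'a \<Rightarrow> 'b::{banach, second_countable_topology}"
    and Y :: "nat \<Rightarrow> 'a \<Rightarrow> 'b"
  assumes X_measurable [measurable]: "X \<in> borel_measurable M"
    and indep: "indep_vars (\<lambda>_. borel) Y UNIV"
    and ident: "\<And>k. distr M borel (Y k) = distr M borel X"
begin

lemma Y_measurable [measurable]: "Y k \<in> borel_measurable M"
  using indep by (auto simp: indep_vars_def)

lemma ident_nn_integral:
  assumes [measurable]: "f \<in> borel_measurable borel"
  shows "(\<integral>\<^sup>+\<omega>. f (Y k \<omega>) \<partial>M) = (\<integral>\<^sup>+\<omega>. f (X \<omega>) \<partial>M)"
  using ident[of k] nn_integral_distr[of "Y k" M borel f] nn_integral_distr[of X M borel f] by simp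

lemma indep_nn_integral_mult:
  fixes f g :: "(nat \<Rightarrow> 'b) \<Rightarrow> ennreal"
  assumes "I \<inter> J = {}"
    and [measurable]: "f \<in> borel_measurable (PiM I (\<lambda>_. borel))" "g \<in> borel_measurable (PiM J (\<lambda>_. borel))"
  shows "(\<integral>\<^sup>+\<omega>. f (\<lambda>k\<in>I. Y k \<omega>) * g (\<lambda>k\<in>J. Y k \<omega>) \<partial>M) =
    (\<integral>\<^sup>+\<omega>. f (\<lambda>k\<in>I. Y k \<omega>) \<partial>M) * (\<integral>\<^sup>+\<omega>. g (\<lambda>k\<in>J. Y k \<omega>) \<partial>M)"
proof -
  have "indep_var borel (f \<circ> (\<lambda>\<omega>. \<lambda>k\<in>I. Y k \<omega>)) borel (g \<circ> (\<lambda>\<omega>. \<lambda>k\<in>J. Y k \<omega>))"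
    by (intro indep_var_compose[OF indep_var_restrict[OF indep]] assms) auto
  then have "indep_vars (\<lambda>_. borel) (case_bool (f \<circ> (\<lambda>\<omega>. \<lambda>k\<in>I. Y k \<omega>)) (g \<circ> (\<lambda>\<omega>. \<lambda>k\<in>J. Y k \<omega>))) UNIV"
    unfolding indep_var_def by (rule back_subst[of "\<lambda>N. indep_vars N _ _"]) (auto split: bool.split)
  from indep_vars_nn_integral[OF _ this] show ?thesis
    by (simp add: UNIV_bool mult.commute comp_def)
qed

lemma indep_var_sum_insert:
  assumes "finite I" "i \<notin> I"
  shows "indep_var borel (Y i) borel (\<lambda>\<omega>. \<Sum>k\<in>I. Y k \<omega>)"
proof -
  have "indep_var borel ((\<lambda>f. f i) \<circ> (\<lambda>\<omega>. \<lambda>k\<in>{i}. Y k \<omega>)) borel ((\<lambda>f. \<Sum>k\<in>I. f k) \<circ> (\<lambda>\<omega>. \<lambda>k\<in>I. Y k \<omega>))"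
    using assms by (intro indep_var_compose[OF indep_var_restrict[OF indep]]) auto
  then show ?thesis by (simp add: comp_def cong: sum.cong)
qed

lemma distr_sum_cong_card:
  assumes "finite I" "finite J" "card I = card J"
  shows "distr M borel (\<lambda>\<omega>. \<Sum>k\<in>I. Y k \<omega>) = distr M borel (\<lambda>\<omega>. \<Sum>k\<in>J. Y k \<omega>)"
  using assms
proof (induction I arbitrary: J)
  case empty
  then show ?case by simp
next
  case (insert i I)
  then obtain j J' where J: "J = insert j J'" "j \<notin> J'" "finite J'" "card J' = card I"
    by (metis card_Suc_eq_finite card_insert_disjoint)
  have *: "distr M borel (\<lambda>\<omega>. \<Sum>k\<in>insert a A. Y k \<omega>) =
      distr (distr M borel X \<Otimes>\<^sub>M distr M borel (\<lambda>\<omega>. \<Sum>k\<in>A. Y k \<omega>)) borel (\<lambda>(x, y). x + y)"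
    if "finite A" "a \<notin> A" for a A
  proof -
    have "distr M borel X \<Otimes>\<^sub>M distr M borel (\<lambda>\<omega>. \<Sum>k\<in>A. Y k \<omega>) =
        distr M (borel \<Otimes>\<^sub>M borel) (\<lambda>\<omega>. (Y a \<omega>, \<Sum>k\<in>A. Y k \<omega>))"
      using indep_var_sum_insert[OF that] unfolding indep_var_distribution_eq by (simp add: ident)
    then show ?thesis
      using that by (simp add: distr_distr comp_def)
  qed
  have "distr M borel (\<lambda>\<omega>. \<Sum>k\<in>I. Y k \<omega>) = distr M borel (\<lambda>\<omega>. \<Sum>k\<in>J'. Y k \<omega>)"
    using insert.IH[OF J(3)] J(4) by simp
  then show ?case
    unfolding J(1) *[OF insert.hyps] *[OF J(3,2)] by (rule arg_cong)
qed

definition mean_norm :: "nat \<Rightarrow> ennreal" where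
  "mean_norm n = (\<integral>\<^sup>+\<omega>. norm (\<Sum>k<n. Y k \<omega>) \<partial>M)"

lemma mean_norm_card:
  assumes "finite I"
  shows "(\<integral>\<^sup>+\<omega>. norm (\<Sum>k\<in>I. Y k \<omega>) \<partial>M) = mean_norm (card I)"
proof -
  have "(\<integral>\<^sup>+\<omega>. norm (\<Sum>k\<in>I. Y k \<omega>) \<partial>M) = (\<integral>\<^sup>+x. norm x \<partial>distr M borel (\<lambda>\<omega>. \<Sum>k\<in>I. Y k \<omega>))"
    by (simp add: nn_integral_distr)
  also have "\<dots> = mean_norm (card I)"
    by (subst distr_sum_cong_card[of I "{..<card I}"]) (auto simp: assms nn_integral_distr mean_norm_def)
  finally show ?thesis .
qed

lemma mean_norm_1: "mean_norm 1 = (\<integral>\<^sup>+\<omega>. norm (X \<omega>) \<partial>M)"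
  using ident_nn_integral[of norm 0] by (simp add: mean_norm_def)

lemma mean_norm_le: "mean_norm n \<le> of_nat n * (\<integral>\<^sup>+\<omega>. norm (X \<omega>) \<partial>M)"
proof -
  have "mean_norm n \<le> (\<integral>\<^sup>+\<omega>. (\<Sum>k<n. ennreal (norm (Y k \<omega>))) \<partial>M)"
    unfolding mean_norm_def by (intro nn_integral_mono) (auto intro: norm_sum ennreal_leI)
  also have "\<dots> = of_nat n * (\<integral>\<^sup>+\<omega>. norm (X \<omega>) \<partial>M)"
    by (simp add: nn_integral_sum ident_nn_integral[of "\<lambda>x. ennreal (norm x)"] del: sum_ennreal)
  finally show ?thesis .
qed

subsection \<open>Necessity\<close>

lemma tail_le_mean_norm:
  fixes c :: real
  assumes small: "of_nat n * (\<integral>\<^sup>+\<omega>. indicator {x. norm x > c} (X \<omega>) \<partial>M) \<le> (1/2 :: ennreal)"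
  shows "of_nat n * (\<integral>\<^sup>+\<omega>. ennreal (norm (X \<omega>)) * indicator {x. norm x > c} (X \<omega>) \<partial>M) \<le>
    2 * mean_norm n + mean_norm (n - 1)"
proof -
  define u :: "'b \<Rightarrow> ennreal" where "u = indicator {x. norm x > c}"
  have [measurable]: "u \<in> borel_measurable borel" unfolding u_def by measurable
  define J where "J k = {..<n} - {k}" for k
  define b :: "nat \<Rightarrow> (nat \<Rightarrow> 'b) \<Rightarrow> ennreal"
    where "b k x = (if \<forall>j\<in>J k. norm (x j) \<le> c then 1 else 0)" for k x
  have finJ [simp]: "finite (J k)" for k by (simp add: J_def)
  have [measurable]: "b k \<in> borel_measurable (PiM (J k) (\<lambda>_. borel))" for k
    unfolding b_def by measurable
  define W where "W k \<omega> = b k (\<lambda>j\<in>J k. Y j \<omega>)" for k \<omega>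
  have W: "W k \<omega> = (if \<forall>j\<in>J k. norm (Y j \<omega>) \<le> c then 1 else 0)" for k \<omega>
    by (auto simp: W_def b_def)
  have [measurable]: "W k \<in> borel_measurable M" for k
    unfolding W_def by measurable
  define D where "D = (\<integral>\<^sup>+\<omega>. ennreal (norm (X \<omega>)) * u (X \<omega>) \<partial>M)"
  define p where "p = (\<integral>\<^sup>+\<omega>. u (X \<omega>) \<partial>M)"
  have p: "of_nat n * p \<le> 1/2" using small unfolding p_def u_def .
  define T where "T k \<omega> = (\<Sum>j\<in>J k. Y j \<omega>)" for k \<omega>
  have [measurable]: "T k \<in> borel_measurable M" for k unfolding T_def by measurable

  have W_half: "1/2 \<le> (\<integral>\<^sup>+\<omega>. W k \<omega> \<partial>M)" if "k < n" for k
  proof (rule ennreal_half_le_of_one_le_add[OF _ p])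
    have "1 = (\<integral>\<^sup>+\<omega>. 1 \<partial>M)" by (simp add: emeasure_space_1)
    also have "\<dots> \<le> (\<integral>\<^sup>+\<omega>. W k \<omega> + (\<Sum>j<n. u (Y j \<omega>)) \<partial>M)"
    proof (rule nn_integral_mono)
      fix \<omega>
      show "1 \<le> W k \<omega> + (\<Sum>j<n. u (Y j \<omega>))"
      proof (cases "\<forall>j\<in>J k. norm (Y j \<omega>) \<le> c")
        case False
        then obtain j where "j \<in> J k" "u (Y j \<omega>) = 1" by (auto simp: u_def)
        then have "1 \<le> (\<Sum>j<n. u (Y j \<omega>))"
          using member_le_sum[of j "{..<n}" "\<lambda>j. u (Y j \<omega>)"] by (auto simp: J_def)
        then show ?thesis by (simp add: add_increasing)
      qed (auto simp: W)
    qed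
    also have "\<dots> = (\<integral>\<^sup>+\<omega>. W k \<omega> \<partial>M) + of_nat n * p"
      by (simp add: nn_integral_add nn_integral_sum ident_nn_integral p_def)
    finally show "1 \<le> (\<integral>\<^sup>+\<omega>. W k \<omega> \<partial>M) + of_nat n * p" .
  qed

  have J_disjoint: "{k} \<inter> J k = {}" for k by (simp add: J_def)
  have DW: "(\<integral>\<^sup>+\<omega>. ennreal (norm (Y k \<omega>)) * u (Y k \<omega>) * W k \<omega> \<partial>M) = D * (\<integral>\<^sup>+\<omega>. W k \<omega> \<partial>M)" for k
  proof -
    have "(\<integral>\<^sup>+\<omega>. ennreal (norm (Y k \<omega>)) * u (Y k \<omega>) * W k \<omega> \<partial>M) =
        (\<integral>\<^sup>+\<omega>. ennreal (norm (Y k \<omega>)) * u (Y k \<omega>) \<partial>M) * (\<integral>\<^sup>+\<omega>. W k \<omega> \<partial>M)"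
      unfolding W_def
      using indep_nn_integral_mult[OF J_disjoint[of k], where f = "\<lambda>x. ennreal (norm (x k)) * u (x k)" and g = "b k"]
      by simp
    then show ?thesis
      using ident_nn_integral[of "\<lambda>x. ennreal (norm x) * u x" k] by (simp add: D_def)
  qed

  have uT: "(\<integral>\<^sup>+\<omega>. u (Y k \<omega>) * ennreal (norm (T k \<omega>)) \<partial>M) = p * mean_norm (n - 1)" if "k < n" for k
  proof -
    have "(\<integral>\<^sup>+\<omega>. u (Y k \<omega>) * ennreal (norm (T k \<omega>)) \<partial>M) =
        (\<integral>\<^sup>+\<omega>. u (Y k \<omega>) \<partial>M) * (\<integral>\<^sup>+\<omega>. ennreal (norm (T k \<omega>)) \<partial>M)"
      unfolding T_def
      using indep_nn_integral_mult[OF J_disjoint[of k], where f = "\<lambda>x. u (x k)" and g = "\<lambda>x. ennreal (norm (\<Sum>j\<in>J k. x j))"]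
      by simp
    also have "(\<integral>\<^sup>+\<omega>. ennreal (norm (T k \<omega>)) \<partial>M) = mean_norm (n - 1)"
      unfolding T_def using that by (simp add: mean_norm_card J_def)
    finally show ?thesis
      using ident_nn_integral[of u k] by (simp add: p_def)
  qed

  have disjoint: "(\<Sum>k<n. u (Y k \<omega>) * W k \<omega>) \<le> 1" for \<omega>
  proof (cases "\<exists>k<n. u (Y k \<omega>) * W k \<omega> \<noteq> 0")
    case True
    then obtain k where k: "k < n" "norm (Y k \<omega>) > c" "\<forall>j\<in>J k. norm (Y j \<omega>) \<le> c"
      by (auto simp: u_def W indicator_def split: if_splits)
    then have "u (Y j \<omega>) * W j \<omega> = 0" if "j < n" "j \<noteq> k" for j
    proof -
      have "norm (Y j \<omega>) \<le> c" using k that by (auto simp: J_def)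
      then show ?thesis by (simp add: u_def)
    qed
    then have "(\<Sum>j<n. u (Y j \<omega>) * W j \<omega>) = (\<Sum>j\<in>{k}. u (Y j \<omega>) * W j \<omega>)"
      using k by (intro sum.mono_neutral_right) auto
    also have "\<dots> = u (Y k \<omega>) * W k \<omega>" by simp
    also have "\<dots> \<le> 1 * 1" by (intro mult_mono) (auto simp: u_def W indicator_def)
    also have "\<dots> = 1" by simp
    finally show ?thesis .
  next
    case False
    then have "(\<Sum>k<n. u (Y k \<omega>) * W k \<omega>) = 0" by (intro sum.neutral) blast
    then show ?thesis by (simp only: zero_le_one)
  qed

  have split: "ennreal (norm (Y k \<omega>)) * u (Y k \<omega>) * W k \<omega> \<le>
      ennreal (norm (\<Sum>j<n. Y j \<omega>)) * (u (Y k \<omega>) * W k \<omega>) + u (Y k \<omega>) * ennreal (norm (T k \<omega>))" if "k < n" for k \<omega>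
  proof -
    have "(\<Sum>j<n. Y j \<omega>) = Y k \<omega> + T k \<omega>"
      unfolding T_def J_def using that by (subst sum.remove[of _ k]) auto
    then have "norm (Y k \<omega>) \<le> norm (\<Sum>j<n. Y j \<omega>) + norm (T k \<omega>)"
      using norm_triangle_ineq4[of "Y k \<omega> + T k \<omega>" "T k \<omega>"] by simp
    then have "ennreal (norm (Y k \<omega>)) \<le> ennreal (norm (\<Sum>j<n. Y j \<omega>)) + ennreal (norm (T k \<omega>))"
      by (simp flip: ennreal_plus)
    then show ?thesis by (auto simp: u_def W indicator_def)
  qed

  have "of_nat n * (D * (1/2)) = (\<Sum>k<n. D * (1/2))" by simp
  also have "\<dots> \<le> (\<Sum>k<n. D * (\<integral>\<^sup>+\<omega>. W k \<omega> \<partial>M))"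
    by (intro sum_mono mult_left_mono W_half) auto
  also have "\<dots> = (\<integral>\<^sup>+\<omega>. (\<Sum>k<n. ennreal (norm (Y k \<omega>)) * u (Y k \<omega>) * W k \<omega>) \<partial>M)"
    by (simp add: nn_integral_sum DW)
  also have "\<dots> \<le> (\<integral>\<^sup>+\<omega>. (\<Sum>k<n. ennreal (norm (\<Sum>j<n. Y j \<omega>)) * (u (Y k \<omega>) * W k \<omega>) + u (Y k \<omega>) * ennreal (norm (T k \<omega>))) \<partial>M)"
    by (intro nn_integral_mono sum_mono split) auto
  also have "\<dots> = (\<integral>\<^sup>+\<omega>. ennreal (norm (\<Sum>j<n. Y j \<omega>)) * (\<Sum>k<n. u (Y k \<omega>) * W k \<omega>) + (\<Sum>k<n. u (Y k \<omega>) * ennreal (norm (T k \<omega>))) \<partial>M)"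
    by (simp add: sum.distrib sum_distrib_left)
  also have "\<dots> \<le> (\<integral>\<^sup>+\<omega>. ennreal (norm (\<Sum>j<n. Y j \<omega>)) + (\<Sum>k<n. u (Y k \<omega>) * ennreal (norm (T k \<omega>))) \<partial>M)"
    using disjoint by (intro nn_integral_mono add_right_mono mult_left_le) auto
  also have "\<dots> = mean_norm n + (\<Sum>k<n. p * mean_norm (n - 1))"
    by (simp add: nn_integral_add nn_integral_sum uT mean_norm_def[of n])
  also have "\<dots> = mean_norm n + (of_nat n * p) * mean_norm (n - 1)"
    by (simp add: mult.assoc)
  also have "\<dots> \<le> mean_norm n + (1/2) * mean_norm (n - 1)"
    by (intro add_left_mono mult_right_mono p) auto
  finally have "2 * (of_nat n * (D * (1/2))) \<le> 2 * (mean_norm n + (1/2) * mean_norm (n - 1))"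
    by (rule mult_left_mono) auto
  moreover have two: "2 * (1/2 :: ennreal) = 1"
    using ennreal_mult_divide_eq[of 2 1] by (simp add: ennreal_times_divide)
  have "2 * (of_nat n * (D * (1/2))) = of_nat n * D * (2 * (1/2))" by (simp only: ac_simps)
  then have "2 * (of_nat n * (D * (1/2))) = of_nat n * D" unfolding two by simp
  moreover have "2 * (mean_norm n + (1/2) * mean_norm (n - 1)) = 2 * mean_norm n + 2 * (1/2) * mean_norm (n - 1)"
    by (simp only: distrib_left mult.assoc)
  then have "2 * (mean_norm n + (1/2) * mean_norm (n - 1)) = 2 * mean_norm n + mean_norm (n - 1)"
    unfolding two by simp
  ultimately show ?thesis by (simp only: D_def u_def)
qed

lemma mean_norm_1_less_top:
  assumes "(\<Sum>n. mean_norm (Suc n) / ennreal ((real (Suc n))\<^sup>2)) < \<infinity>"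
  shows "(\<integral>\<^sup>+\<omega>. ennreal (norm (X \<omega>)) \<partial>M) < \<infinity>"
proof -
  have "(\<Sum>n\<in>{0}. mean_norm (Suc n) / ennreal ((real (Suc n))\<^sup>2)) \<le>
      (\<Sum>n. mean_norm (Suc n) / ennreal ((real (Suc n))\<^sup>2))"
    by (intro sum_le_suminf) auto
  also note assms
  finally show ?thesis using mean_norm_1 by (simp add: divide_ennreal_def)
qed

lemma mean_norm_shift_summable:
  assumes "(\<Sum>n. mean_norm (Suc n) / ennreal ((real (Suc n))\<^sup>2)) < \<infinity>"
  shows "(\<Sum>n. mean_norm n / ennreal ((real (Suc n))\<^sup>2)) < \<infinity>"
proof -
  have "(\<Sum>n. mean_norm n / ennreal ((real (Suc n))\<^sup>2)) =
      (\<Sum>n. mean_norm (n + 1) / ennreal ((real (Suc (n + 1)))\<^sup>2)) +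
      (\<Sum>n<1. mean_norm n / ennreal ((real (Suc n))\<^sup>2))"
    by (rule suminf_offset) auto
  also have "(\<Sum>n<1. mean_norm n / ennreal ((real (Suc n))\<^sup>2)) = 0"
    by (simp add: mean_norm_def)
  also have "(\<Sum>n. mean_norm (n + 1) / ennreal ((real (Suc (n + 1)))\<^sup>2)) \<le>
      (\<Sum>n. mean_norm (Suc n) / ennreal ((real (Suc n))\<^sup>2))"
    unfolding Suc_eq_plus1[symmetric]
    by (intro suminf_le divide_left_mono_ennreal ennreal_leI power_mono) auto
  also note assms
  finally show ?thesis by simp
qed

lemma nn_integral_norm_ln_less_top:
  assumes fin: "(\<Sum>n. mean_norm (Suc n) / ennreal ((real (Suc n))\<^sup>2)) < \<infinity>"
  shows "(\<integral>\<^sup>+\<omega>. ennreal (norm (X \<omega>) * ln (1 + norm (X \<omega>))) \<partial>M) < \<infinity>"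
proof -
  define \<mu> where "\<mu> = enn2real (\<integral>\<^sup>+\<omega>. ennreal (norm (X \<omega>)) \<partial>M)"
  have \<mu>: "(\<integral>\<^sup>+\<omega>. ennreal (norm (X \<omega>)) \<partial>M) = ennreal \<mu>" "\<mu> \<ge> 0"
    unfolding \<mu>_def using mean_norm_1_less_top[OF fin] by (auto simp: less_top)
  define a where "a = 2 * \<mu> + 1"
  have a: "a > 0" using \<mu> by (simp add: a_def)
  define D where "D m = (\<integral>\<^sup>+\<omega>. ennreal (norm (X \<omega>)) * indicator {x. norm x > a * real (Suc m)} (X \<omega>) \<partial>M)" for m
  have small: "of_nat (Suc m) * (\<integral>\<^sup>+\<omega>. indicator {x. norm x > a * real (Suc m)} (X \<omega>) \<partial>M) \<le> (1/2 :: ennreal)" for m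
  proof -
    have "of_nat (Suc m) * (\<integral>\<^sup>+\<omega>. indicator {x. norm x > a * real (Suc m)} (X \<omega>) \<partial>M) =
        (\<integral>\<^sup>+\<omega>. ennreal (real (Suc m)) * indicator {x. norm x > a * real (Suc m)} (X \<omega>) \<partial>M)"
      by (simp add: nn_integral_cmult flip: ennreal_of_nat_eq_real_of_nat del: of_nat_Suc)
    also have "\<dots> \<le> (\<integral>\<^sup>+\<omega>. ennreal (1 / a) * ennreal (norm (X \<omega>)) \<partial>M)"
      using a by (intro nn_integral_mono)
        (auto simp: indicator_def field_simps simp flip: ennreal_mult simp del: of_nat_Suc intro!: ennreal_leI)
    also have "\<dots> = ennreal (\<mu> / a)"
      using \<mu> a by (subst nn_integral_cmult) (auto simp flip: ennreal_mult)
    also have "\<dots> \<le> ennreal (1 / 2)"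
      using \<mu> by (intro ennreal_leI) (simp add: a_def field_simps)
    finally show ?thesis by (simp add: divide_ennreal_def)
  qed
  have D: "D m / ennreal (real (Suc m)) \<le>
      2 * (mean_norm (Suc m) / ennreal ((real (Suc m))\<^sup>2)) + mean_norm m / ennreal ((real (Suc m))\<^sup>2)" for m
  proof -
    have "D m / ennreal (real (Suc m)) = (of_nat (Suc m) * D m) / ennreal ((real (Suc m))\<^sup>2)"
    proof -
      have "(of_nat (Suc m) * D m) / ennreal ((real (Suc m))\<^sup>2) =
          D m * (ennreal (real (Suc m)) * inverse (ennreal ((real (Suc m))\<^sup>2)))"
        unfolding divide_ennreal_def by (simp only: ennreal_of_nat_eq_real_of_nat[symmetric] ac_simps)
      also have "ennreal (real (Suc m)) * inverse (ennreal ((real (Suc m))\<^sup>2)) = inverse (ennreal (real (Suc m)))"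
        by (simp add: inverse_ennreal power2_eq_square flip: ennreal_mult del: of_nat_Suc)
      finally show ?thesis by (simp only: divide_ennreal_def)
    qed
    also have "\<dots> \<le> (2 * mean_norm (Suc m) + mean_norm m) / ennreal ((real (Suc m))\<^sup>2)"
      using tail_le_mean_norm[OF small, of m] unfolding D_def
      by (intro divide_right_mono_ennreal) simp
    finally show ?thesis by (simp only: add_divide_distrib_ennreal ennreal_times_divide)
  qed
  have "(\<integral>\<^sup>+\<omega>. ennreal (norm (X \<omega>) * ln (1 + norm (X \<omega>))) \<partial>M) \<le>
      (\<integral>\<^sup>+\<omega>. ennreal (ln (1 + a)) * ennreal (norm (X \<omega>)) +
        (\<Sum>m. ennreal (norm (X \<omega>)) * indicator {x. norm x > a * real (Suc m)} (X \<omega>) / ennreal (real (Suc m))) \<partial>M)"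
  proof (rule nn_integral_mono)
    fix \<omega>
    have "indicator {x. norm x > a * real (Suc m)} (X \<omega>) = (indicator {a * real (Suc m)<..} (norm (X \<omega>)) :: ennreal)" for m
      by (simp add: indicator_def)
    then show "ennreal (norm (X \<omega>) * ln (1 + norm (X \<omega>))) \<le> ennreal (ln (1 + a)) * ennreal (norm (X \<omega>)) +
        (\<Sum>m. ennreal (norm (X \<omega>)) * indicator {x. norm x > a * real (Suc m)} (X \<omega>) / ennreal (real (Suc m)))"
      using mult_ln_le_harmonic_series[of "norm (X \<omega>)" a] a by (simp only: norm_ge_zero)
  qed
  also have "\<dots> = ennreal (ln (1 + a)) * ennreal \<mu> + (\<Sum>m. D m / ennreal (real (Suc m)))"
    by (simp add: nn_integral_add nn_integral_cmult nn_integral_suminf nn_integral_divide \<mu> D_def del: of_nat_Suc)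
  also have "(\<Sum>m. D m / ennreal (real (Suc m))) \<le>
      (\<Sum>m. 2 * (mean_norm (Suc m) / ennreal ((real (Suc m))\<^sup>2)) + mean_norm m / ennreal ((real (Suc m))\<^sup>2))"
    by (intro suminf_le D) auto
  also have "\<dots> = 2 * (\<Sum>m. mean_norm (Suc m) / ennreal ((real (Suc m))\<^sup>2)) + (\<Sum>m. mean_norm m / ennreal ((real (Suc m))\<^sup>2))"
    by (simp only: suminf_add[symmetric] ennreal_suminf_cmult summableI)
  also have "ennreal (ln (1 + a)) * ennreal \<mu> + \<dots> < \<infinity>"
    using fin mean_norm_shift_summable[OF fin] by (simp add: ennreal_mult_less_top ennreal_add_less_top del: of_nat_Suc)
  finally show ?thesis by (simp add: add_left_mono)
qed

lemma weak_mean_zero: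
  fixes \<phi> :: "'b \<Rightarrow> real"
  assumes fin: "(\<Sum>n. mean_norm (Suc n) / ennreal ((real (Suc n))\<^sup>2)) < \<infinity>"
    and "bounded_linear \<phi>"
  shows "integrable M (\<lambda>\<omega>. \<phi> (X \<omega>)) \<and> (\<integral>\<omega>. \<phi> (X \<omega>) \<partial>M) = 0"
proof
  interpret bounded_linear \<phi> by fact
  have [measurable]: "\<phi> \<in> borel_measurable borel"
    by (intro borel_measurable_continuous_onI continuous_on continuous_on_id)
  obtain K where K: "K > 0" "\<And>x. \<bar>\<phi> x\<bar> \<le> norm x * K" using pos_bounded by auto
  have X: "integrable M X"
    using mean_norm_1_less_top[OF fin] by (intro integrableI_bounded) auto
  then show \<phi>X: "integrable M (\<lambda>\<omega>. \<phi> (X \<omega>))" by (rule integrable_bounded_linear[OF assms(2)])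
  define e where "e = (\<integral>\<omega>. \<phi> (X \<omega>) \<partial>M)"
  have Y: "integrable M (\<lambda>\<omega>. \<phi> (Y k \<omega>))" "(\<integral>\<omega>. \<phi> (Y k \<omega>) \<partial>M) = e" for k
  proof -
    have "integrable (distr M borel (Y k)) \<phi>"
      unfolding ident using \<phi>X by (simp add: integrable_distr_eq)
    then show "integrable M (\<lambda>\<omega>. \<phi> (Y k \<omega>))" by (simp add: integrable_distr_eq)
    show "(\<integral>\<omega>. \<phi> (Y k \<omega>) \<partial>M) = e"
      using integral_distr[of "Y k" M borel \<phi>] integral_distr[of X M borel \<phi>] ident[of k]
      by (simp add: e_def)
  qed
  have bound: "ennreal (\<bar>e\<bar> / real (Suc n)) \<le> ennreal K * (mean_norm (Suc n) / ennreal ((real (Suc n))\<^sup>2))" for n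
  proof -
    have "real (Suc n) * e = (\<integral>\<omega>. \<phi> (\<Sum>k<Suc n. Y k \<omega>) \<partial>M)"
      unfolding sum by (subst Bochner_Integration.integral_sum) (auto simp: Y)
    then have "ennreal (real (Suc n) * \<bar>e\<bar>) = ennreal (norm (\<integral>\<omega>. \<phi> (\<Sum>k<Suc n. Y k \<omega>) \<partial>M))"
      by (metis abs_mult abs_of_nat real_norm_def)
    also have "\<dots> \<le> (\<integral>\<^sup>+\<omega>. norm (\<phi> (\<Sum>k<Suc n. Y k \<omega>)) \<partial>M)"
      by (rule integral_norm_bound_ennreal) (auto simp: sum Y simp del: sum.lessThan_Suc)
    also have "\<dots> \<le> (\<integral>\<^sup>+\<omega>. ennreal K * ennreal (norm (\<Sum>k<Suc n. Y k \<omega>)) \<partial>M)"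
      using K by (intro nn_integral_mono) (simp add: mult.commute ennreal_leI del: sum.lessThan_Suc flip: ennreal_mult)
    also have "\<dots> = ennreal K * mean_norm (Suc n)"
      by (simp add: nn_integral_cmult mean_norm_def del: sum.lessThan_Suc)
    finally have "ennreal (real (Suc n) * \<bar>e\<bar>) / ennreal ((real (Suc n))\<^sup>2) \<le>
        ennreal K * mean_norm (Suc n) / ennreal ((real (Suc n))\<^sup>2)"
      by (rule divide_right_mono_ennreal)
    also have "ennreal (real (Suc n) * \<bar>e\<bar>) / ennreal ((real (Suc n))\<^sup>2) = ennreal (\<bar>e\<bar> / real (Suc n))"
      by (simp add: divide_ennreal power2_eq_square del: of_nat_Suc)
    finally show ?thesis by (simp only: ennreal_times_divide)
  qed
  have "(\<Sum>n. ennreal (\<bar>e\<bar> / real (Suc n))) \<le> (\<Sum>n. ennreal K * (mean_norm (Suc n) / ennreal ((real (Suc n))\<^sup>2)))"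
    by (intro suminf_le bound) auto
  also have "\<dots> < \<infinity>" using fin by (simp add: ennreal_mult_less_top)
  finally have "summable (\<lambda>n. \<bar>e\<bar> / real (Suc n))"
    by (intro summable_suminf_not_top) auto
  then have "summable (\<lambda>n. \<bar>e\<bar> * inverse (real n))"
    by (subst summable_Suc_iff[symmetric]) (simp add: divide_inverse)
  then show "(\<integral>\<omega>. \<phi> (X \<omega>) \<partial>M) = 0"
    using not_summable_harmonic[where 'a = real] unfolding summable_cmult_iff e_def by simp
qed

lemma AE_summable_weighted:
  assumes fin: "(\<Sum>n. mean_norm (Suc n) / ennreal ((real (Suc n))\<^sup>2)) < \<infinity>"
  shows "AE \<omega> in M. summable (\<lambda>n. norm (\<Sum>k<Suc n. Y k \<omega>) / (real (Suc n))\<^sup>2)"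
proof -
  define f where "f n \<omega> = norm (\<Sum>k<Suc n. Y k \<omega>) / (real (Suc n))\<^sup>2" for n \<omega>
  have [measurable]: "f n \<in> borel_measurable M" for n unfolding f_def by measurable
  have "(\<integral>\<^sup>+\<omega>. ennreal (f n \<omega>) \<partial>M) = mean_norm (Suc n) / ennreal ((real (Suc n))\<^sup>2)" for n
    unfolding f_def mean_norm_def
    by (subst nn_integral_divide[symmetric]) (auto simp: divide_ennreal simp del: sum.lessThan_Suc of_nat_Suc)
  then have "(\<integral>\<^sup>+\<omega>. (\<Sum>n. ennreal (f n \<omega>)) \<partial>M) < \<infinity>"
    using fin by (subst nn_integral_suminf) auto
  then have "AE \<omega> in M. (\<Sum>n. ennreal (f n \<omega>)) \<noteq> \<infinity>"
    by (intro nn_integral_noteq_infinite) auto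
  then show ?thesis
  proof eventually_elim
    case (elim \<omega>)
    then have "summable (\<lambda>n. f n \<omega>)"
      by (intro summable_suminf_not_top) (auto simp: f_def)
    then show ?case by (simp only: f_def)
  qed
qed

subsection \<open>Integrability of the largest average\<close>

lemma truncated_average_variance:
  fixes c :: real
  assumes "n > 0" "c \<ge> 0"
  defines "z \<equiv> \<lambda>x :: 'b. norm x * indicator {x. norm x \<le> c} x"
  shows "(\<integral>\<^sup>+\<omega>. ennreal (((\<Sum>k<n. z (Y k \<omega>)) / real n - expectation (\<lambda>\<omega>. z (X \<omega>)))\<^sup>2) \<partial>M) \<le>
    (\<integral>\<^sup>+\<omega>. ennreal ((norm (X \<omega>))\<^sup>2 * indicator {..c} (norm (X \<omega>)) / real n) \<partial>M)"
proof -
  define e where "e = expectation (\<lambda>\<omega>. z (X \<omega>))"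
  define W where "W k \<omega> = z (Y k \<omega>) - e" for k \<omega>
  have [measurable]: "z \<in> borel_measurable borel" unfolding z_def by measurable
  have z: "0 \<le> z x" "z x \<le> c" for x using assms by (auto simp: z_def indicator_def)
  have transfer: "expectation (\<lambda>\<omega>. f (Y k \<omega>)) = expectation (\<lambda>\<omega>. f (X \<omega>))"
    if "f \<in> borel_measurable borel" for f :: "'b \<Rightarrow> real" and k
    using integral_distr[of "Y k" M borel f] integral_distr[of X M borel f] ident[of k] that by simp
  have int_zY: "integrable M (\<lambda>\<omega>. z (Y k \<omega>))" for k
    by (rule integrable_const_bound[of _ c]) (auto simp: z)
  have int_zX: "integrable M (\<lambda>\<omega>. z (X \<omega>))" "integrable M (\<lambda>\<omega>. (z (X \<omega>))\<^sup>2)"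
    by (rule integrable_const_bound[of _ c] integrable_const_bound[of _ "c\<^sup>2"]; auto simp: z power_mono)+
  have int_W: "integrable M (W k)" for k unfolding W_def using int_zY by simp
  have bound_W: "(W k \<omega>)\<^sup>2 \<le> (c + \<bar>e\<bar>)\<^sup>2" for k \<omega>
    unfolding W_def using z[of "Y k \<omega>"] by (intro abs_le_square_iff[THEN iffD1]) auto
  have int_W2: "integrable M (\<lambda>\<omega>. (W k \<omega>)\<^sup>2)" for k
    using bound_W by (intro integrable_const_bound[of _ "(c + \<bar>e\<bar>)\<^sup>2"]) (auto simp: W_def)
  have exp_W: "expectation (W k) = 0" for k
    unfolding W_def using int_zY transfer[of z k] by (simp add: prob_space e_def)
  have "expectation (\<lambda>\<omega>. (W k \<omega>)\<^sup>2) = expectation (\<lambda>\<omega>. (z (X \<omega>))\<^sup>2) - e\<^sup>2" for k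
  proof -
    have "expectation (\<lambda>\<omega>. (W k \<omega>)\<^sup>2) = expectation (\<lambda>\<omega>. (z (X \<omega>) - e)\<^sup>2)"
      unfolding W_def by (rule transfer) simp
    also have "\<dots> = expectation (\<lambda>\<omega>. (z (X \<omega>))\<^sup>2) - e\<^sup>2"
      unfolding e_def using int_zX by (rule variance_eq)
    finally show ?thesis .
  qed
  then have exp_W2: "expectation (\<lambda>\<omega>. (W k \<omega>)\<^sup>2) \<le> expectation (\<lambda>\<omega>. (z (X \<omega>))\<^sup>2)" for k
    by simp
  have "indep_vars (\<lambda>_. borel) W {..<n}"
    unfolding W_def by (rule indep_vars_compose2[OF indep_vars_subset[OF indep]]) auto
  then have sq: "integrable M (\<lambda>\<omega>. (\<Sum>k<n. W k \<omega>)\<^sup>2)"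
    "expectation (\<lambda>\<omega>. (\<Sum>k<n. W k \<omega>)\<^sup>2) = (\<Sum>k<n. expectation (\<lambda>\<omega>. (W k \<omega>)\<^sup>2))"
    using expectation_square_sum_indep[of "{..<n}" W] int_W int_W2 exp_W by auto
  have "expectation (\<lambda>\<omega>. (\<Sum>k<n. W k \<omega>)\<^sup>2) \<le> (\<Sum>k<n. expectation (\<lambda>\<omega>. (z (X \<omega>))\<^sup>2))"
    unfolding sq(2) by (intro sum_mono exp_W2)
  then have le: "expectation (\<lambda>\<omega>. (\<Sum>k<n. W k \<omega>)\<^sup>2) / (real n)\<^sup>2 \<le> expectation (\<lambda>\<omega>. (z (X \<omega>))\<^sup>2) / real n"
    using assms(1) by (simp add: field_simps power2_eq_square)
  have "((\<Sum>k<n. z (Y k \<omega>)) / real n - e)\<^sup>2 = (\<Sum>k<n. W k \<omega>)\<^sup>2 / (real n)\<^sup>2" for \<omega>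
    using assms(1) by (simp add: W_def sum_subtractf diff_divide_distrib flip: power_divide)
  then have "(\<integral>\<^sup>+\<omega>. ennreal (((\<Sum>k<n. z (Y k \<omega>)) / real n - e)\<^sup>2) \<partial>M) =
      (\<integral>\<^sup>+\<omega>. ennreal ((\<Sum>k<n. W k \<omega>)\<^sup>2 / (real n)\<^sup>2) \<partial>M)" by simp
  also have "\<dots> = ennreal (expectation (\<lambda>\<omega>. (\<Sum>k<n. W k \<omega>)\<^sup>2) / (real n)\<^sup>2)"
    using sq(1) by (subst nn_integral_eq_integral) auto
  also have "\<dots> \<le> ennreal (expectation (\<lambda>\<omega>. (z (X \<omega>))\<^sup>2) / real n)"
    using le by (rule ennreal_leI)
  also have "\<dots> = (\<integral>\<^sup>+\<omega>. ennreal ((z (X \<omega>))\<^sup>2 / real n) \<partial>M)"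
    using int_zX by (subst nn_integral_eq_integral) auto
  also have "\<dots> = (\<integral>\<^sup>+\<omega>. ennreal ((norm (X \<omega>))\<^sup>2 * indicator {..c} (norm (X \<omega>)) / real n) \<partial>M)"
    by (intro nn_integral_cong) (auto simp: z_def indicator_def)
  finally show ?thesis unfolding e_def .
qed

lemma nn_integral_norm_less_top:
  assumes "(\<integral>\<^sup>+\<omega>. ennreal (norm (X \<omega>) * ln (1 + norm (X \<omega>))) \<partial>M) < \<infinity>"
  shows "(\<integral>\<^sup>+\<omega>. ennreal (norm (X \<omega>)) \<partial>M) < \<infinity>"
proof -
  have "ennreal x \<le> ennreal 1 + ennreal (1 / ln 2) * ennreal (x * ln (1 + x))" if "x \<ge> 0" for x :: real
  proof -
    have "x \<le> 1 + 1 / ln 2 * (x * ln (1 + x))"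
    proof (cases "x \<le> 1")
      case False
      then have "ln 2 \<le> ln (1 + x)" by simp
      then have "x * ln 2 \<le> x * ln (1 + x)" using that by (rule mult_left_mono)
      then have "x * ln 2 \<le> ln 2 + x * ln (1 + x)" by (rule add_increasing[rotated]) simp
      then show ?thesis by (simp add: field_simps)
    qed (use that in \<open>simp add: add_increasing2\<close>)
    then have "ennreal x \<le> ennreal (1 + 1 / ln 2 * (x * ln (1 + x)))" by (rule ennreal_leI)
    also have "\<dots> = ennreal 1 + ennreal (1 / ln 2 * (x * ln (1 + x)))"
      using that by (intro ennreal_plus) auto
    also have "ennreal (1 / ln 2 * (x * ln (1 + x))) = ennreal (1 / ln 2) * ennreal (x * ln (1 + x))"
      using that by (intro ennreal_mult) auto
    finally show ?thesis .
  qed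
  then have "(\<integral>\<^sup>+\<omega>. ennreal (norm (X \<omega>)) \<partial>M) \<le>
      (\<integral>\<^sup>+\<omega>. ennreal 1 + ennreal (1 / ln 2) * ennreal (norm (X \<omega>) * ln (1 + norm (X \<omega>))) \<partial>M)"
    by (intro nn_integral_mono) auto
  also have "\<dots> = 1 + ennreal (1 / ln 2) * (\<integral>\<^sup>+\<omega>. ennreal (norm (X \<omega>) * ln (1 + norm (X \<omega>))) \<partial>M)"
    by (simp add: nn_integral_add nn_integral_cmult emeasure_space_1)
  also have "\<dots> < \<infinity>" using assms by (simp add: ennreal_mult_less_top)
  finally show ?thesis .
qed

lemma averages_dominated:
  assumes LlogL: "(\<integral>\<^sup>+\<omega>. ennreal (norm (X \<omega>) * ln (1 + norm (X \<omega>))) \<partial>M) < \<infinity>"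
  obtains G :: "'a \<Rightarrow> ennreal" where "G \<in> borel_measurable M" "(\<integral>\<^sup>+\<omega>. G \<omega> \<partial>M) < \<infinity>"
    "\<And>m \<omega>. ennreal (norm (\<Sum>k<m. Y k \<omega>)) \<le> of_nat m * G \<omega>"
proof -
  note L1 = nn_integral_norm_less_top[OF LlogL]
  define z where "z j x = norm x * indicator {x. norm x \<le> 2 ^ j} x" for j :: nat and x :: 'b
  define r where "r j x = norm x * indicator {2 ^ j<..} (norm x)" for j :: nat and x :: 'b
  have [measurable]: "z j \<in> borel_measurable borel" "r j \<in> borel_measurable borel" for j
    unfolding z_def r_def by measurable
  have zr: "0 \<le> z j x" "0 \<le> r j x" "norm x = z j x + r j x" for j x
    by (auto simp: z_def r_def indicator_def)
  define e where "e j = expectation (\<lambda>\<omega>. z j (X \<omega>))" for j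
  define \<mu> where "\<mu> = expectation (\<lambda>\<omega>. norm (X \<omega>))"
  have int: "integrable M (\<lambda>\<omega>. norm (X \<omega>))"
    using L1 by (intro integrableI_bounded) auto
  have e: "e j \<le> \<mu>" for j
    unfolding e_def \<mu>_def using int by (intro integral_mono' ) (auto simp: z_def indicator_def)
  define a where "a j \<omega> = (\<Sum>k<2 ^ j. z j (Y k \<omega>)) / real (2 ^ j)" for j \<omega>
  define b where "b j \<omega> = (\<Sum>k<2 ^ j. r j (Y k \<omega>)) / real (2 ^ j)" for j \<omega>
  have [measurable]: "a j \<in> borel_measurable M" "b j \<in> borel_measurable M" for j
    unfolding a_def b_def by measurable
  have b_nonneg: "0 \<le> b j \<omega>" for j \<omega> unfolding b_def using zr by (intro divide_nonneg_nonneg sum_nonneg) auto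
  \<comment> \<open>\<open>a \<le> e + 1 + (a - e)\<^sup>2\<close> replaces the truncated averages by their variances, which are summable over \<open>j\<close>.\<close>
  define G where "G \<omega> = 2 * (ennreal (\<bar>\<mu>\<bar> + 1) + (\<Sum>j. ennreal ((a j \<omega> - e j)\<^sup>2)) + (\<Sum>j. ennreal (b j \<omega>)))" for \<omega>
  show ?thesis
  proof
    show [measurable]: "G \<in> borel_measurable M" unfolding G_def by measurable
    have "(\<integral>\<^sup>+\<omega>. ennreal ((a j \<omega> - e j)\<^sup>2) \<partial>M) \<le>
        (\<integral>\<^sup>+\<omega>. ennreal ((norm (X \<omega>))\<^sup>2 * indicator {..2 ^ j} (norm (X \<omega>)) / 2 ^ j) \<partial>M)" for j
      using truncated_average_variance[of "2 ^ j" "2 ^ j"] by (simp add: a_def e_def z_def)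
    then have "(\<Sum>j. \<integral>\<^sup>+\<omega>. ennreal ((a j \<omega> - e j)\<^sup>2) \<partial>M) \<le>
        (\<Sum>j. \<integral>\<^sup>+\<omega>. ennreal ((norm (X \<omega>))\<^sup>2 * indicator {..2 ^ j} (norm (X \<omega>)) / 2 ^ j) \<partial>M)"
      by (intro suminf_le) auto
    also have "\<dots> = (\<integral>\<^sup>+\<omega>. (\<Sum>j. ennreal ((norm (X \<omega>))\<^sup>2 * indicator {..2 ^ j} (norm (X \<omega>)) / 2 ^ j)) \<partial>M)"
      by (subst nn_integral_suminf) auto
    also have "\<dots> \<le> (\<integral>\<^sup>+\<omega>. 2 * ennreal (norm (X \<omega>)) \<partial>M)"
      using dyadic_tail_sum_squares by (intro nn_integral_mono) (simp add: ennreal_mult)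
    also have "\<dots> < \<infinity>" using L1 by (simp add: nn_integral_cmult ennreal_mult_less_top)
    finally have fin_a: "(\<Sum>j. \<integral>\<^sup>+\<omega>. ennreal ((a j \<omega> - e j)\<^sup>2) \<partial>M) < \<infinity>" .

    have "(\<integral>\<^sup>+\<omega>. ennreal (b j \<omega>) \<partial>M) = (\<integral>\<^sup>+\<omega>. ennreal (r j (X \<omega>)) \<partial>M)" for j
    proof -
      have "(\<integral>\<^sup>+\<omega>. ennreal (b j \<omega>) \<partial>M) = (\<integral>\<^sup>+\<omega>. ennreal (1 / 2 ^ j) * (\<Sum>k<2 ^ j. ennreal (r j (Y k \<omega>))) \<partial>M)"
        using zr by (intro nn_integral_cong) (simp add: b_def sum_nonneg flip: ennreal_mult)
      also have "\<dots> = ennreal (1 / 2 ^ j) * (\<Sum>k<2 ^ j. \<integral>\<^sup>+\<omega>. ennreal (r j (Y k \<omega>)) \<partial>M)"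
        by (subst nn_integral_cmult) (auto simp: nn_integral_sum simp del: sum_ennreal)
      also have "\<dots> = ennreal (1 / 2 ^ j) * ennreal (2 ^ j) * (\<integral>\<^sup>+\<omega>. ennreal (r j (X \<omega>)) \<partial>M)"
        using ident_nn_integral[of "\<lambda>x. ennreal (r j x)"]
        by (simp add: mult.assoc ennreal_power[symmetric] del: ennreal_power)
      also have "ennreal (1 / 2 ^ j) * ennreal (2 ^ j) = 1"
        by (subst ennreal_mult[symmetric]) auto
      finally show ?thesis by simp
    qed
    then have "(\<Sum>j. \<integral>\<^sup>+\<omega>. ennreal (b j \<omega>) \<partial>M) = (\<integral>\<^sup>+\<omega>. (\<Sum>j. ennreal (r j (X \<omega>))) \<partial>M)"
      by (subst nn_integral_suminf) auto
    also have "\<dots> \<le> (\<integral>\<^sup>+\<omega>. ennreal (norm (X \<omega>)) + ennreal (1 / ln 2) * ennreal (norm (X \<omega>) * ln (1 + norm (X \<omega>))) \<partial>M)"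
      unfolding r_def using dyadic_tail_sum_le_mult_ln by (intro nn_integral_mono) simp
    also have "\<dots> < \<infinity>"
      using L1 LlogL by (simp add: nn_integral_add nn_integral_cmult ennreal_mult_less_top)
    finally have fin_b: "(\<Sum>j. \<integral>\<^sup>+\<omega>. ennreal (b j \<omega>) \<partial>M) < \<infinity>" .

    have "(\<integral>\<^sup>+\<omega>. G \<omega> \<partial>M) = 2 * (ennreal (\<bar>\<mu>\<bar> + 1) + (\<Sum>j. \<integral>\<^sup>+\<omega>. ennreal ((a j \<omega> - e j)\<^sup>2) \<partial>M) + (\<Sum>j. \<integral>\<^sup>+\<omega>. ennreal (b j \<omega>) \<partial>M))"
      unfolding G_def by (simp add: nn_integral_cmult nn_integral_add nn_integral_suminf emeasure_space_1)
    also have "\<dots> < \<infinity>" using fin_a fin_b by (simp add: ennreal_mult_less_top)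
    finally show "(\<integral>\<^sup>+\<omega>. G \<omega> \<partial>M) < \<infinity>" .

    show "ennreal (norm (\<Sum>k<m. Y k \<omega>)) \<le> of_nat m * G \<omega>" for m \<omega>
    proof (cases "m = 0")
      case False
      then obtain j where j: "m \<le> 2 ^ j" "(2 :: nat) ^ j \<le> 2 * m" using exists_dyadic_between by blast
      have j': "2 ^ j \<le> 2 * real m" using j(2) by (metis of_nat_le_iff of_nat_mult of_nat_numeral of_nat_power)
      have "norm (\<Sum>k<m. Y k \<omega>) \<le> (\<Sum>k<m. norm (Y k \<omega>))" by (rule norm_sum)
      also have "\<dots> \<le> (\<Sum>k<2 ^ j. norm (Y k \<omega>))" using j by (intro sum_mono2) auto
      also have "\<dots> = 2 ^ j * (a j \<omega> + b j \<omega>)"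
        unfolding zr(3)[of "Y _ \<omega>" j] by (simp add: a_def b_def sum.distrib flip: add_divide_distrib)
      also have "\<dots> \<le> 2 ^ j * ((\<bar>\<mu>\<bar> + 1) + (a j \<omega> - e j)\<^sup>2 + b j \<omega>)"
      proof -
        have "t \<le> 1 + t\<^sup>2" for t :: real
          using sum_power2_ge_zero[of "t - 1/2" 0] by (simp add: power2_eq_square algebra_simps)
        from this[of "a j \<omega> - e j"] e[of j] show ?thesis by (intro mult_left_mono) auto
      qed
      also have "\<dots> \<le> (2 * real m) * ((\<bar>\<mu>\<bar> + 1) + (a j \<omega> - e j)\<^sup>2 + b j \<omega>)"
        using j' b_nonneg[of j \<omega>] by (intro mult_right_mono) auto
      finally have "ennreal (norm (\<Sum>k<m. Y k \<omega>)) \<le> ennreal ((2 * real m) * ((\<bar>\<mu>\<bar> + 1) + (a j \<omega> - e j)\<^sup>2 + b j \<omega>))"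
        by (rule ennreal_leI)
      also have "\<dots> = of_nat m * (2 * (ennreal (\<bar>\<mu>\<bar> + 1) + ennreal ((a j \<omega> - e j)\<^sup>2) + ennreal (b j \<omega>)))"
      proof -
        define w where "w = (\<bar>\<mu>\<bar> + 1) + (a j \<omega> - e j)\<^sup>2 + b j \<omega>"
        have "w \<ge> 0" using b_nonneg[of j \<omega>] by (simp add: w_def)
        then have "ennreal ((2 * real m) * w) = of_nat m * (2 * ennreal w)"
          by (simp add: ennreal_mult ennreal_of_nat_eq_real_of_nat mult_ac)
        also have "ennreal w = ennreal (\<bar>\<mu>\<bar> + 1) + ennreal ((a j \<omega> - e j)\<^sup>2) + ennreal (b j \<omega>)"
          using b_nonneg[of j \<omega>] by (simp add: w_def)
        finally show ?thesis by (simp only: w_def)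
      qed
      also have "\<dots> \<le> of_nat m * G \<omega>"
      proof -
        have "f j \<le> (\<Sum>i. f i)" for f :: "nat \<Rightarrow> ennreal"
          using sum_le_suminf[of f "{j}"] by simp
        then show ?thesis unfolding G_def by (intro mult_left_mono add_mono) auto
      qed
      finally show ?thesis .
    qed simp
  qed
qed

subsection \<open>Sufficiency\<close>

definition weighted_sum :: "nat \<Rightarrow> 'a \<Rightarrow> real" where
  "weighted_sum N \<omega> = (\<Sum>n<N. norm (\<Sum>k<Suc n. Y k \<omega>) / (real (Suc n))\<^sup>2)"

lemma weighted_sum_measurable [measurable]: "weighted_sum N \<in> borel_measurable M"
  unfolding weighted_sum_def by measurable

lemma weighted_sum_mono: "m \<le> N \<Longrightarrow> weighted_sum m \<omega> \<le> weighted_sum N \<omega>"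
  unfolding weighted_sum_def by (intro sum_mono2) auto

lemma nn_integral_weighted_sum:
  "(\<integral>\<^sup>+\<omega>. ennreal (weighted_sum N \<omega>) \<partial>M) = (\<Sum>n<N. mean_norm (Suc n) / ennreal ((real (Suc n))\<^sup>2))"
proof -
  have "(\<integral>\<^sup>+\<omega>. ennreal (weighted_sum N \<omega>) \<partial>M) =
      (\<integral>\<^sup>+\<omega>. (\<Sum>n<N. ennreal (norm (\<Sum>k<Suc n. Y k \<omega>)) / ennreal ((real (Suc n))\<^sup>2)) \<partial>M)"
    unfolding weighted_sum_def
    by (intro nn_integral_cong) (simp add: divide_ennreal del: of_nat_Suc sum.lessThan_Suc flip: sum_ennreal)
  also have "\<dots> = (\<Sum>n<N. mean_norm (Suc n) / ennreal ((real (Suc n))\<^sup>2))"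
    by (simp add: nn_integral_sum nn_integral_divide mean_norm_def del: of_nat_Suc sum.lessThan_Suc)
  finally show ?thesis .
qed

definition crossing :: "real \<Rightarrow> nat \<Rightarrow> 'a \<Rightarrow> ennreal" where
  "crossing t i \<omega> = (if weighted_sum i \<omega> \<le> t \<and> t < weighted_sum (Suc i) \<omega> then 1 else 0)"

lemma crossing_measurable [measurable]: "crossing t i \<in> borel_measurable M"
  unfolding crossing_def by measurable

lemma sum_crossing:
  assumes "t \<ge> 0"
  shows "(\<Sum>i<N. crossing t i \<omega>) = (if t < weighted_sum N \<omega> then 1 else 0)"
proof (induction N)
  case (Suc N)
  then show ?case
    using weighted_sum_mono[of N "Suc N" \<omega>] by (auto simp: crossing_def)
qed (use assms in \<open>simp add: weighted_sum_def\<close>)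

text \<open>
  The terms after a first crossing at \<open>Suc i\<close>, with \<open>\<parallel>S\<^bsub>Suc i\<^esub>\<parallel>\<close> split off. The natural denominators
  \<open>(Suc i + Suc j)\<^sup>2\<close> are lowered to \<open>(Suc j)\<^sup>2\<close>, so that the mean is that of a weighted sum.
\<close>

definition remainder :: "nat \<Rightarrow> nat \<Rightarrow> 'a \<Rightarrow> real" where
  "remainder i d \<omega> = (\<Sum>j<d. norm (\<Sum>k\<in>{Suc i..<Suc i + Suc j}. Y k \<omega>) / (real (Suc j))\<^sup>2)"

lemma remainder_nonneg: "0 \<le> remainder i d \<omega>"
  unfolding remainder_def by (intro sum_nonneg) auto

lemma remainder_measurable [measurable]: "remainder i d \<in> borel_measurable M"
  unfolding remainder_def by measurable

lemma nn_integral_remainder: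
  "(\<integral>\<^sup>+\<omega>. ennreal (remainder i d \<omega>) \<partial>M) = (\<Sum>n<d. mean_norm (Suc n) / ennreal ((real (Suc n))\<^sup>2))"
proof -
  have "(\<integral>\<^sup>+\<omega>. ennreal (remainder i d \<omega>) \<partial>M) =
      (\<integral>\<^sup>+\<omega>. (\<Sum>j<d. ennreal (norm (\<Sum>k\<in>{Suc i..<Suc i + Suc j}. Y k \<omega>)) / ennreal ((real (Suc j))\<^sup>2)) \<partial>M)"
    unfolding remainder_def
    by (intro nn_integral_cong) (simp add: divide_ennreal del: of_nat_Suc flip: sum_ennreal)
  also have "\<dots> = (\<Sum>j<d. (\<integral>\<^sup>+\<omega>. ennreal (norm (\<Sum>k\<in>{Suc i..<Suc i + Suc j}. Y k \<omega>)) \<partial>M) / ennreal ((real (Suc j))\<^sup>2))"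
    by (simp add: nn_integral_sum nn_integral_divide del: of_nat_Suc)
  also have "\<dots> = (\<Sum>n<d. mean_norm (Suc n) / ennreal ((real (Suc n))\<^sup>2))"
    by (subst mean_norm_card) auto
  finally show ?thesis .
qed

lemma nn_integral_crossing_remainder:
  "(\<integral>\<^sup>+\<omega>. crossing t i \<omega> * ennreal (remainder i d \<omega>) \<partial>M) =
    (\<integral>\<^sup>+\<omega>. crossing t i \<omega> \<partial>M) * (\<integral>\<^sup>+\<omega>. ennreal (remainder i d \<omega>) \<partial>M)"
proof -
  define I where "I = {..<Suc i}"
  define J where "J = {Suc i..<Suc i + Suc d}"
  define q where "q m x = (\<Sum>n<m. norm (\<Sum>k<Suc n. x k) / (real (Suc n))\<^sup>2)" for m and x :: "nat \<Rightarrow> 'b"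
  define f :: "(nat \<Rightarrow> 'b) \<Rightarrow> ennreal" where "f x = (if q i x \<le> t \<and> t < q (Suc i) x then 1 else 0)" for x
  define g :: "(nat \<Rightarrow> 'b) \<Rightarrow> ennreal" where
    "g x = ennreal (\<Sum>j<d. norm (\<Sum>k\<in>{Suc i..<Suc i + Suc j}. x k) / (real (Suc j))\<^sup>2)" for x
  have [measurable]: "q m \<in> borel_measurable (PiM I (\<lambda>_. borel))" if "m \<le> Suc i" for m
    unfolding q_def using that
    by (intro borel_measurable_sum borel_measurable_divide borel_measurable_norm borel_measurable_const
        measurable_component_singleton) (auto simp: I_def)
  have [measurable]: "f \<in> borel_measurable (PiM I (\<lambda>_. borel))" unfolding f_def by measurable
  have [measurable]: "g \<in> borel_measurable (PiM J (\<lambda>_. borel))"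
    unfolding g_def
    by (intro measurable_compose[OF _ measurable_ennreal] borel_measurable_sum borel_measurable_divide
        borel_measurable_norm borel_measurable_const measurable_component_singleton) (auto simp: J_def simp del: sum.op_ivl_Suc)
  have q: "q m (\<lambda>k\<in>I. Y k \<omega>) = weighted_sum m \<omega>" if "m \<le> Suc i" for m \<omega>
    unfolding q_def weighted_sum_def using that
    by (intro sum.cong refl arg_cong2[where f = "(/)"] arg_cong[where f = norm]) (auto simp: I_def)
  have f: "f (\<lambda>k\<in>I. Y k \<omega>) = crossing t i \<omega>" for \<omega>
    by (simp add: f_def crossing_def q)
  have g: "g (\<lambda>k\<in>J. Y k \<omega>) = ennreal (remainder i d \<omega>)" for \<omega>
    unfolding g_def remainder_def
    by (intro sum.cong refl arg_cong2[where f = "(/)"] arg_cong[where f = norm] arg_cong[where f = ennreal]) (auto simp: J_def)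
  have "I \<inter> J = {}" by (auto simp: I_def J_def)
  from indep_nn_integral_mult[OF this, of f g] show ?thesis
    by (simp add: f g)
qed

lemma weighted_sum_le_at_crossing:
  assumes "t < weighted_sum N \<omega>" "t \<ge> 0"
  obtains i where "i < N" "crossing t i \<omega> = 1"
    "weighted_sum N \<omega> \<le> t + 2 * (norm (\<Sum>k<Suc i. Y k \<omega>) / real (Suc i)) + remainder i (N - Suc i) \<omega>"
proof -
  have "\<not> t < weighted_sum 0 \<omega>" using assms(2) by (simp add: weighted_sum_def)
  then obtain i where i: "i < N" "weighted_sum i \<omega> \<le> t" "t < weighted_sum (Suc i) \<omega>"
    using ex_least_nat_less[of "\<lambda>m. t < weighted_sum m \<omega>" N] assms(1) by (auto simp: not_less)
  define d where "d = N - Suc i"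
  have N: "N = Suc i + d" using i(1) by (simp add: d_def)
  define s where "s = norm (\<Sum>k<Suc i. Y k \<omega>)"
  have "s \<ge> 0" by (simp add: s_def)
  have "(\<Sum>j<d. norm (\<Sum>k<Suc (Suc i + j). Y k \<omega>) / (real (Suc (Suc i + j)))\<^sup>2) \<le>
      (\<Sum>j<d. s * (1 / (real (Suc (Suc i + j)))\<^sup>2) +
        norm (\<Sum>k\<in>{Suc i..<Suc i + Suc j}. Y k \<omega>) / (real (Suc j))\<^sup>2)"
  proof (rule sum_mono)
    fix j
    define u where "u = norm (\<Sum>k\<in>{Suc i..<Suc i + Suc j}. Y k \<omega>)"
    have "(\<Sum>k<Suc (Suc i + j). Y k \<omega>) = (\<Sum>k<Suc i. Y k \<omega>) + (\<Sum>k\<in>{Suc i..<Suc i + Suc j}. Y k \<omega>)"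
      using sum.atLeastLessThan_concat[of 0 "Suc i" "Suc i + Suc j" "\<lambda>k. Y k \<omega>"]
      unfolding lessThan_atLeast0 by (simp del: sum.op_ivl_Suc)
    then have "norm (\<Sum>k<Suc (Suc i + j). Y k \<omega>) \<le> s + u"
      by (simp only: s_def u_def norm_triangle_ineq)
    then have "norm (\<Sum>k<Suc (Suc i + j). Y k \<omega>) / (real (Suc (Suc i + j)))\<^sup>2 \<le> (s + u) / (real (Suc (Suc i + j)))\<^sup>2"
      by (rule divide_right_mono) simp
    also have "\<dots> = s * (1 / (real (Suc (Suc i + j)))\<^sup>2) + u / (real (Suc (Suc i + j)))\<^sup>2"
      by (simp add: add_divide_distrib)
    also have "u / (real (Suc (Suc i + j)))\<^sup>2 \<le> u / (real (Suc j))\<^sup>2"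
      by (intro divide_left_mono power_mono) (auto simp: u_def)
    finally show "norm (\<Sum>k<Suc (Suc i + j). Y k \<omega>) / (real (Suc (Suc i + j)))\<^sup>2 \<le>
        s * (1 / (real (Suc (Suc i + j)))\<^sup>2) + u / (real (Suc j))\<^sup>2" by simp
  qed
  also have "\<dots> = s * (\<Sum>j<d. 1 / (real (Suc (Suc i + j)))\<^sup>2) + remainder i d \<omega>"
    by (simp only: sum.distrib sum_distrib_left remainder_def)
  also have "s * (\<Sum>j<d. 1 / (real (Suc (Suc i + j)))\<^sup>2) \<le> s * (1 / real (Suc i))"
  proof (rule mult_left_mono)
    have "0 \<le> 1 / real (Suc i + d)" by simp
    then show "(\<Sum>j<d. 1 / (real (Suc (Suc i + j)))\<^sup>2) \<le> 1 / real (Suc i)"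
      using sum_inverse_squares_le[of i d] by linarith
  qed fact
  finally have tail: "(\<Sum>j<d. norm (\<Sum>k<Suc (Suc i + j). Y k \<omega>) / (real (Suc (Suc i + j)))\<^sup>2) \<le>
      s / real (Suc i) + remainder i d \<omega>" by simp
  have "s / (real (Suc i))\<^sup>2 \<le> s / real (Suc i)"
    using \<open>s \<ge> 0\<close> by (intro divide_left_mono) (auto simp: power2_eq_square)
  moreover have "weighted_sum (Suc i) \<omega> = weighted_sum i \<omega> + s / (real (Suc i))\<^sup>2"
    unfolding weighted_sum_def s_def by (simp only: sum.lessThan_Suc)
  moreover have "weighted_sum N \<omega> = weighted_sum (Suc i) \<omega> +
      (\<Sum>j<d. norm (\<Sum>k<Suc (Suc i + j). Y k \<omega>) / (real (Suc (Suc i + j)))\<^sup>2)"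
    unfolding weighted_sum_def N by (rule sum_lessThan_add)
  ultimately have "weighted_sum N \<omega> \<le> t + 2 * (s / real (Suc i)) + remainder i d \<omega>"
    using i(2) tail by linarith
  then show ?thesis
    using i that[of i] by (simp add: crossing_def s_def d_def)
qed

lemma summable_mean_norm:
  assumes conv: "AE \<omega> in M. summable (\<lambda>n. norm (\<Sum>k<Suc n. Y k \<omega>) / (real (Suc n))\<^sup>2)"
    and LlogL: "(\<integral>\<^sup>+\<omega>. ennreal (norm (X \<omega>) * ln (1 + norm (X \<omega>))) \<partial>M) < \<infinity>"
  shows "(\<Sum>n. mean_norm (Suc n) / ennreal ((real (Suc n))\<^sup>2)) < \<infinity>"
proof -
  obtain G :: "'a \<Rightarrow> ennreal" where G [measurable]: "G \<in> borel_measurable M"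
    and int_G: "(\<integral>\<^sup>+\<omega>. G \<omega> \<partial>M) < \<infinity>"
    and dom: "\<And>m \<omega>. ennreal (norm (\<Sum>k<m. Y k \<omega>)) \<le> of_nat m * G \<omega>"
    using averages_dominated[OF LlogL] by blast
  define EQ where "EQ N = (\<Sum>n<N. mean_norm (Suc n) / ennreal ((real (Suc n))\<^sup>2))" for N
  have EQ_mono: "m \<le> N \<Longrightarrow> EQ m \<le> EQ N" for m N
    unfolding EQ_def by (intro sum_mono2) auto
  have EQ_finite: "EQ N < \<infinity>" for N
  proof -
    have "mean_norm n < \<infinity>" for n
      using mean_norm_le[of n] nn_integral_norm_less_top[OF LlogL]
      by (auto intro: order.strict_trans1 simp: ennreal_mult_less_top of_nat_less_top)
    then show ?thesis
      unfolding EQ_def by (auto simp: less_top[symmetric] ennreal_divide_eq_top_iff simp del: of_nat_Suc)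
  qed

  define A where "A m = {\<omega> \<in> space M. \<exists>N. real m < weighted_sum N \<omega>}" for m
  have [measurable]: "A m \<in> sets M" for m unfolding A_def by measurable
  have "(\<lambda>m. measure M (A m)) \<longlonglongrightarrow> measure M (\<Inter>m. A m)"
  proof (rule finite_Lim_measure_decseq)
    show "decseq A" unfolding A_def by (intro decseq_SucI Collect_mono impI) (metis lessI less_trans of_nat_less_iff)
  qed auto
  also have "measure M (\<Inter>m. A m) = 0"
  proof -
    have "AE \<omega> in M. \<omega> \<notin> (\<Inter>m. A m)"
      using conv
    proof eventually_elim
      case (elim \<omega>)
      obtain m :: nat where m: "(\<Sum>n. norm (\<Sum>k<Suc n. Y k \<omega>) / (real (Suc n))\<^sup>2) \<le> real m"
        using real_arch_simple by blast
      have "weighted_sum N \<omega> \<le> (\<Sum>n. norm (\<Sum>k<Suc n. Y k \<omega>) / (real (Suc n))\<^sup>2)" for N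
        unfolding weighted_sum_def using elim by (intro sum_le_suminf) auto
      then have "weighted_sum N \<omega> \<le> real m" for N using m order_trans by blast
      then have "\<omega> \<notin> A m" by (simp add: A_def not_less)
      then show ?case by blast
    qed
    moreover have "(\<Inter>m. A m) \<in> sets M" by measurable
    ultimately show ?thesis by (subst prob_eq_0) auto
  qed
  finally have "eventually (\<lambda>m. measure M (A m) < 1/2) sequentially"
    by (rule order_tendstoD) simp
  then obtain m where m: "measure M (A m) < 1/2" by (auto simp: eventually_sequentially)
  define t where "t = real m"
  have t: "t \<ge> 0" by (simp add: t_def)
  have half: "(\<integral>\<^sup>+\<omega>. (\<Sum>i<N. crossing t i \<omega>) \<partial>M) \<le> ennreal (1/2)" for N
  proof -
    have "(\<integral>\<^sup>+\<omega>. (\<Sum>i<N. crossing t i \<omega>) \<partial>M) \<le> (\<integral>\<^sup>+\<omega>. indicator (A m) \<omega> \<partial>M)"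
      unfolding sum_crossing[OF t] by (intro nn_integral_mono) (auto simp: A_def t_def indicator_def)
    also have "\<dots> \<le> ennreal (1/2)"
      using m by (simp add: emeasure_eq_measure ennreal_leI del: ennreal_half)
    finally show ?thesis .
  qed

  have pointwise: "ennreal (weighted_sum N \<omega>) \<le> ennreal t + 2 * G \<omega> +
      (\<Sum>i<N. crossing t i \<omega> * ennreal (remainder i (N - Suc i) \<omega>))" for N \<omega>
  proof (cases "t < weighted_sum N \<omega>")
    case True
    then obtain i where i: "i < N" "crossing t i \<omega> = 1"
      "weighted_sum N \<omega> \<le> t + 2 * (norm (\<Sum>k<Suc i. Y k \<omega>) / real (Suc i)) + remainder i (N - Suc i) \<omega>"
      using weighted_sum_le_at_crossing t by blast
    have "ennreal (norm (\<Sum>k<Suc i. Y k \<omega>) / real (Suc i)) \<le> G \<omega>"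
    proof -
      have "ennreal (norm (\<Sum>k<Suc i. Y k \<omega>) / real (Suc i)) = ennreal (norm (\<Sum>k<Suc i. Y k \<omega>)) / ennreal (real (Suc i))"
        by (simp add: divide_ennreal del: of_nat_Suc sum.lessThan_Suc)
      also have "\<dots> \<le> of_nat (Suc i) * G \<omega> / ennreal (real (Suc i))"
        by (rule divide_right_mono_ennreal[OF dom])
      also have "\<dots> = G \<omega>"
        by (simp add: mult.commute[of _ "G \<omega>"] ennreal_mult_divide_eq flip: ennreal_of_nat_eq_real_of_nat del: of_nat_Suc)
      finally show ?thesis .
    qed
    then have "ennreal (2 * (norm (\<Sum>k<Suc i. Y k \<omega>) / real (Suc i))) \<le> 2 * G \<omega>"
      by (subst ennreal_mult) (auto intro: mult_left_mono simp del: of_nat_Suc sum.lessThan_Suc)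
    moreover have "ennreal (remainder i (N - Suc i) \<omega>) \<le>
        (\<Sum>i<N. crossing t i \<omega> * ennreal (remainder i (N - Suc i) \<omega>))"
      using i member_le_sum[of i "{..<N}" "\<lambda>i. crossing t i \<omega> * ennreal (remainder i (N - Suc i) \<omega>)"] by simp
    moreover have "ennreal (weighted_sum N \<omega>) \<le> ennreal t +
        ennreal (2 * (norm (\<Sum>k<Suc i. Y k \<omega>) / real (Suc i))) + ennreal (remainder i (N - Suc i) \<omega>)"
      using ennreal_leI[OF i(3)] t remainder_nonneg
      by (simp add: ennreal_plus[symmetric] del: ennreal_plus of_nat_Suc sum.lessThan_Suc)
    ultimately show ?thesis
      by (meson add_left_mono add_mono order_trans)
  next
    case False
    then have "ennreal (weighted_sum N \<omega>) \<le> ennreal t" by (intro ennreal_leI) simp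
    then show ?thesis by (simp add: add_increasing2 add.assoc)
  qed

  define C where "C = ennreal t + 2 * (\<integral>\<^sup>+\<omega>. G \<omega> \<partial>M)"
  have C: "C < \<infinity>" using int_G by (simp add: C_def ennreal_mult_less_top)
  have EQ_le: "EQ N \<le> 2 * C" for N
  proof -
    have "EQ N = (\<integral>\<^sup>+\<omega>. ennreal (weighted_sum N \<omega>) \<partial>M)"
      by (simp only: nn_integral_weighted_sum EQ_def)
    also have "\<dots> \<le> (\<integral>\<^sup>+\<omega>. ennreal t + 2 * G \<omega> +
        (\<Sum>i<N. crossing t i \<omega> * ennreal (remainder i (N - Suc i) \<omega>)) \<partial>M)"
      by (intro nn_integral_mono pointwise)
    also have "\<dots> = C + (\<Sum>i<N. (\<integral>\<^sup>+\<omega>. crossing t i \<omega> \<partial>M) * EQ (N - Suc i))"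
      by (simp add: nn_integral_add nn_integral_cmult nn_integral_sum emeasure_space_1 C_def
          nn_integral_crossing_remainder nn_integral_remainder EQ_def)
    also have "\<dots> \<le> C + (\<Sum>i<N. (\<integral>\<^sup>+\<omega>. crossing t i \<omega> \<partial>M) * EQ N)"
      by (intro add_left_mono sum_mono mult_left_mono EQ_mono) auto
    also have "\<dots> = C + (\<integral>\<^sup>+\<omega>. (\<Sum>i<N. crossing t i \<omega>) \<partial>M) * EQ N"
      by (simp add: nn_integral_sum sum_distrib_right)
    also have "\<dots> \<le> C + ennreal (1/2) * EQ N"
      by (intro add_left_mono mult_right_mono half) auto
    finally have le: "EQ N \<le> C + ennreal (1/2) * EQ N" .
    obtain x where x: "EQ N = ennreal x" "x \<ge> 0" using EQ_finite[of N] by (cases "EQ N") auto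
    obtain c where c: "C = ennreal c" "c \<ge> 0" using C by (cases C) auto
    have "ennreal (1/2) * ennreal x = ennreal (1/2 * x)"
      using x by (intro ennreal_mult[symmetric]) auto
    moreover have "ennreal (c + 1/2 * x) = ennreal c + ennreal (1/2 * x)"
      using x c by (intro ennreal_plus) auto
    ultimately have "ennreal x \<le> ennreal (c + 1/2 * x)"
      using le x c by (simp only:)
    then have "x \<le> 2 * c" using x c by (subst (asm) ennreal_le_iff) auto
    then have "ennreal x \<le> ennreal (2 * c)" by (rule ennreal_leI)
    then show ?thesis using x c by (simp add: ennreal_mult)
  qed
  have "(\<Sum>n. mean_norm (Suc n) / ennreal ((real (Suc n))\<^sup>2)) = (SUP N. EQ N)"
    unfolding EQ_def by (rule suminf_eq_SUP)
  also have "\<dots> \<le> 2 * C" by (intro SUP_least EQ_le)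
  also have "\<dots> < \<infinity>" using C by (simp add: ennreal_mult_less_top)
  finally show ?thesis .
qed

end

theorem theorem2p2:
  fixes M :: "'a measure"
    and X :: "'a \<Rightarrow> 'b::{banach, second_countable_topology}"
    and Xs :: "nat \<Rightarrow> 'a \<Rightarrow> 'b"
    and S :: "nat \<Rightarrow> 'a \<Rightarrow> 'b"
  assumes "prob_space M"
    and "X \<in> borel_measurable M"
    and "prob_space.indep_vars M (\<lambda>_. borel) Xs {1..}"
    and "\<And>i. i \<ge> 1 \<Longrightarrow> distr M borel (Xs i) = distr M borel X"
    and "\<And>n \<omega>. S n \<omega> = (\<Sum>k\<in>{1..n}. Xs k \<omega>)"
  shows "(\<Sum>n. (\<integral>\<^sup>+ \<omega>. ennreal (norm (S (Suc n) \<omega>)) \<partial>M) / ennreal ((real (Suc n))\<^sup>2)) < \<infinity>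
     \<longleftrightarrow>
     ((AE \<omega> in M. summable (\<lambda>n. norm (S (Suc n) \<omega>) / (real (Suc n))\<^sup>2))
      \<and> (\<forall>\<phi> :: 'b \<Rightarrow> real. bounded_linear \<phi> \<longrightarrow>
            integrable M (\<lambda>\<omega>. \<phi> (X \<omega>)) \<and> (\<integral>\<omega>. \<phi> (X \<omega>) \<partial>M) = 0)
      \<and> (\<integral>\<^sup>+ \<omega>. ennreal (norm (X \<omega>) * ln (1 + norm (X \<omega>))) \<partial>M) < \<infinity>)"
proof -
  interpret prob_space M by fact
  define Y where "Y = (\<lambda>k. Xs (Suc k))"
  have "indep_vars (\<lambda>j. PiM {Suc j} (\<lambda>_. borel)) (\<lambda>j \<omega>. \<lambda>i\<in>{Suc j}. Xs i \<omega>) UNIV"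
    by (rule indep_vars_restrict[OF assms(3)]) (auto simp: disjoint_family_on_def)
  from indep_vars_compose2[OF this, of "\<lambda>j x. x (Suc j)" "\<lambda>_. borel"]
  have "indep_vars (\<lambda>_. borel) Y UNIV" by (simp add: Y_def)
  then interpret iid_sequence M X Y
    by unfold_locales (auto simp: assms Y_def)
  have S: "S (Suc n) \<omega> = (\<Sum>k<Suc n. Y k \<omega>)" for n \<omega>
    unfolding assms(5) Y_def One_nat_def by (rule sum.atLeast1_atMost_eq)
  show ?thesis
    unfolding S mean_norm_def[symmetric]
    using AE_summable_weighted weak_mean_zero nn_integral_norm_ln_less_top summable_mean_norm by blast
qed

end
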